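(* For $k=1,2,\dots,l$, let $\{T_{k,i}\}_{i\in I}\subseteq X_F^{*}$ be a $p$-frame associated to $(a_2,\dots,a_n)$ for $X$ and let $\{R_{k,i}\}_{i\in I}\subseteq X_F^{*}$ be any sequence. Suppose $Q:l^p\to l^p$ is a bounded linear operator such that, for some $m\in\{1,2,\dots,l\}$ and all $x\in X$, $$Q\Big(\Big\{\sum_{k=1}^{l}R_{k,i}(x,a_2,\dots,a_n)\Big\}_{i\in I}\Big)=\{T_{m,i}(x,a_2,\dots,a_n)\}_{i\in I}.$$ If there exists a non-negative constant $\lambda$ such that $$\sum_{i\in I}\big|(T_{k,i}-R_{k,i})(x,a_2,\dots,a_n)\big|^p\le\lambda\sum_{i\in I}|T_{k,i}(x,a_2,\dots,a_n)|^p\qquad\text{for all }x\in X,\ k=1,2,\dots,l,$$ then $\big\{\sum_{k=1}^{l}R_{k,i}\big\}_{i\in I}$ is a $p$-frame associated to $(a_2,\dots,a_n)$ for $X$.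
   Context: Let $\mathbb K\in\{\mathbb R,\mathbb C\}$, $n\ge 2$, $p\in(1,\infty)$, and let $I$ be a countable index set; $l^p$ is the space of $p$-summable $\mathbb K$-valued sequences indexed by $I$. An $n$-norm on a linear space $X$ over $\mathbb K$ is a map $\|\cdot,\dots,\cdot\|_X:X^n\to\mathbb R$ such that (i) $\|x_1,\dots,x_n\|_X=0$ iff $x_1,\dots,x_n$ are linearly dependent; (ii) it is invariant under permutations of its arguments; (iii) $\|\alpha x_1,x_2,\dots,x_n\|_X=|\alpha|\,\|x_1,\dots,x_n\|_X$ for $\alpha\in\mathbb K$; (iv) $\|x+y,x_2,\dots,x_n\|_X\le\|x,x_2,\dots,x_n\|_X+\|y,x_2,\dots,x_n\|_X$. A sequence $\{x_k\}$ converges to $x$ if $\|x_k-x,x_2,\dots,x_n\|_X\to0$ for all $x_2,\dots,x_n\in X$, and is Cauchy if $\|x_l-x_k,x_2,\dots,x_n\|_X\to0$ as $l,k\to\infty$ for all $x_2,\dots,x_n\in X$; $X$ is an $n$-Banach space if every Cauchy sequence converges. $X$ is an $n$-Banach space and $a_2,\dots,a_n\in X$ are fixed. A bounded $b$-linear functional on $X\times\langle a_2\rangle\times\cdots\times\langle a_n\rangle$ ($\langle a_i\rangle$ is the subspace generated by $a_i$) is a map $T$ from this set to $\mathbb K$ with $T(x+y,a_2,\dots,a_n)=T(x,a_2,\dots,a_n)+T(y,a_2,\dots,a_n)$, $T(kx,a_2,\dots,a_n)=kT(x,a_2,\dots,a_n)$ for $x,y\in X$, $k\in\mathbb K$, and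 for which there is $M>0$ with $|T(x,a_2,\dots,a_n)|\le M\|x,a_2,\dots,a_n\|_X$ for all $x\in X$. $X_F^{*}$ is the space of all of these. A countable family $\{T_i\}_{i\in I}\subseteq X_F^{*}$ is a $p$-frame associated to $(a_2,\dots,a_n)$ for $X$ if there are constants $A,B>0$ with $A\|x,a_2,\dots,a_n\|_X^p\le\sum_{i\in I}|T_i(x,a_2,\dots,a_n)|^p\le B\|x,a_2,\dots,a_n\|_X^p$ for all $x\in X$. *)

theory Defs
  imports "HOL-Analysis.Analysis" "HOL-Library.Multiset"
begin

text \<open>
  The scalar field is a type of class \<open>real_normed_field\<close>.  By the Gelfand--Mazur theorem
  (with multiplicativity of the norm) such a field is isometrically isomorphic to the reals or
  to the complex numbers, so quantifying over the type covers exactly these two cases.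

  Tuples in \<open>X\<^sup>n\<close> are lists of length \<open>n\<close>; the value of an \<open>n\<close>-norm on lists of other lengths is
  irrelevant.
\<close>

locale n_normed_space = vector_space scl
  for scl :: "'k::real_normed_field \<Rightarrow> 'x::ab_group_add \<Rightarrow> 'x" +
  fixes n :: nat and N :: "'x list \<Rightarrow> real"
  assumes n_ge_2: "n \<ge> 2"
    \<comment> \<open>a tuple is linearly dependent as a family, so a repeated entry makes it dependent\<close>
    and N_eq_0_iff: "length xs = n \<Longrightarrow> N xs = 0 \<longleftrightarrow> \<not> (distinct xs \<and> independent (set xs))"
    and N_permute: "length xs = n \<Longrightarrow> mset ys = mset xs \<Longrightarrow> N ys = N xs"
    and N_scale: "length ys = n - 1 \<Longrightarrow> N (scl c x # ys) = norm c * N (x # ys)"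
    and N_triangle: "length ys = n - 1 \<Longrightarrow> N ((x + y) # ys) \<le> N (x # ys) + N (y # ys)"

definition n_tendsto :: "nat \<Rightarrow> ('x::ab_group_add list \<Rightarrow> real) \<Rightarrow> (nat \<Rightarrow> 'x) \<Rightarrow> 'x \<Rightarrow> bool" where
  "n_tendsto n N s x \<longleftrightarrow>
     (\<forall>ys. length ys = n - 1 \<longrightarrow> (\<lambda>k. N ((s k - x) # ys)) \<longlonglongrightarrow> 0)"

definition n_Cauchy :: "nat \<Rightarrow> ('x::ab_group_add list \<Rightarrow> real) \<Rightarrow> (nat \<Rightarrow> 'x) \<Rightarrow> bool" where
  "n_Cauchy n N s \<longleftrightarrow>
     (\<forall>ys. length ys = n - 1 \<longrightarrow>
       ((\<lambda>(l, k). N ((s l - s k) # ys)) \<longlongrightarrow> 0) (sequentially \<times>\<^sub>F sequentially))"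

locale n_Banach_space = n_normed_space +
  assumes n_complete: "n_Cauchy n N s \<Longrightarrow> \<exists>x. n_tendsto n N s x"

text \<open>
  Below, the list \<open>a\<close> is \<open>[a\<^sub>2, \<dots>, a\<^sub>n]\<close>, so that \<open>x # a\<close> is the tuple \<open>(x, a\<^sub>2, \<dots>, a\<^sub>n)\<close>.
  The set \<open>b_domain\<close> is the product of \<open>X\<close> with the subspaces generated by the single entries of
  \<open>a\<close>.  A map on this set is represented by its extension by \<open>0\<close> to all lists.
\<close>

definition b_domain :: "('k::field \<Rightarrow> 'x::ab_group_add \<Rightarrow> 'x) \<Rightarrow> 'x list \<Rightarrow> 'x list set" where
  "b_domain scl a = {x # ys | x ys. list_all2 (\<lambda>y b. y \<in> module.span scl {b}) ys a}"

definition b_dual :: "('k::real_normed_field \<Rightarrow> 'x::ab_group_add \<Rightarrow> 'x) \<Rightarrow> ('x list \<Rightarrow> real)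
    \<Rightarrow> 'x list \<Rightarrow> ('x list \<Rightarrow> 'k) set" where
  "b_dual scl N a = {T.
     (\<forall>v. v \<notin> b_domain scl a \<longrightarrow> T v = 0) \<and>
     (\<forall>x y. T ((x + y) # a) = T (x # a) + T (y # a)) \<and>
     (\<forall>c x. T (scl c x # a) = c * T (x # a)) \<and>
     (\<exists>M>0. \<forall>x. norm (T (x # a)) \<le> M * N (x # a))}"

text \<open>
  An infinite sum of reals that diverges has the value \<open>0\<close> under \<open>infsum\<close>; the finiteness implicit
  in an upper bound on a series of non-negative terms is therefore spelled out as summability.
\<close>

definition p_frame :: "('k::real_normed_field \<Rightarrow> 'x::ab_group_add \<Rightarrow> 'x) \<Rightarrow> ('x list \<Rightarrow> real)
    \<Rightarrow> 'x list \<Rightarrow> real \<Rightarrow> 'i set \<Rightarrow> ('i \<Rightarrow> 'x list \<Rightarrow> 'k) \<Rightarrow> bool" where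
  "p_frame scl N a p I T \<longleftrightarrow>
     (\<forall>i\<in>I. T i \<in> b_dual scl N a) \<and>
     (\<exists>A>0. \<exists>B>0. \<forall>x.
        (\<lambda>i. norm (T i (x # a)) powr p) summable_on I \<and>
        A * N (x # a) powr p \<le> (\<Sum>\<^sub>\<infinity>i\<in>I. norm (T i (x # a)) powr p) \<and>
        (\<Sum>\<^sub>\<infinity>i\<in>I. norm (T i (x # a)) powr p) \<le> B * N (x # a) powr p)"

text \<open>
  A sequence indexed by \<open>I\<close> is represented by its extension by \<open>0\<close> to the whole index type.
\<close>

definition seq_on :: "'i set \<Rightarrow> ('i \<Rightarrow> 'k::zero) \<Rightarrow> 'i \<Rightarrow> 'k" where
  "seq_on I f = (\<lambda>i. if i \<in> I then f i else 0)"

definition lp_space :: "real \<Rightarrow> 'i set \<Rightarrow> ('i \<Rightarrow> 'k::real_normed_field) set" where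
  "lp_space p I = {f. (\<forall>i. i \<notin> I \<longrightarrow> f i = 0) \<and> (\<lambda>i. norm (f i) powr p) summable_on I}"

definition lp_norm :: "real \<Rightarrow> 'i set \<Rightarrow> ('i \<Rightarrow> 'k::real_normed_field) \<Rightarrow> real" where
  "lp_norm p I f = (\<Sum>\<^sub>\<infinity>i\<in>I. norm (f i) powr p) powr (1 / p)"

definition lp_bounded_linear :: "real \<Rightarrow> 'i set
    \<Rightarrow> (('i \<Rightarrow> 'k::real_normed_field) \<Rightarrow> ('i \<Rightarrow> 'k)) \<Rightarrow> bool" where
  "lp_bounded_linear p I Q \<longleftrightarrow>
     (\<forall>f\<in>lp_space p I. Q f \<in> lp_space p I) \<and>
     (\<forall>f\<in>lp_space p I. \<forall>g\<in>lp_space p I. Q (\<lambda>i. f i + g i) = (\<lambda>i. Q f i + Q g i)) \<and>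
     (\<forall>c. \<forall>f\<in>lp_space p I. Q (\<lambda>i. c * f i) = (\<lambda>i. c * Q f i)) \<and>
     (\<exists>C. \<forall>f\<in>lp_space p I. lp_norm p I (Q f) \<le> C * lp_norm p I f)"

end

theory Submission imports Defs begin

text \<open>
  Fix \<open>x\<close>, evaluate all functionals at \<open>x # a\<close>, and call the sum over \<open>I\<close> of the \<open>p\<close>-th powers of
  the norms of a family its \<open>p\<close>-sum.  The upper frame bound and the lower one come from different
  hypotheses: the perturbation inequality and the operator \<open>Q\<close>.

  For the upper bound, \<open>R k i = T k i - (T k i - R k i)\<close>, so the perturbation inequality bounds
  the \<open>p\<close>-sum of \<open>R k\<close> by a multiple of that of \<open>T k\<close>, hence of \<open>N (x # a) powr p\<close>; a finite sum
  over \<open>k\<close> costs one more constant.  Both steps use that the \<open>p\<close>-th power of the norm of a sum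
  of \<open>c\<close> terms is at most \<open>c\<close> to the \<open>p\<close> times the sum of the \<open>p\<close>-th powers
  (\<open>norm_sum_powr_le\<close>), whose constant is not sharp but does not need convexity.

  In particular the sums over \<open>k\<close> of the \<open>R k i\<close> form a sequence in \<open>l\<^sup>p\<close>.  Since \<open>Q\<close> is bounded
  and sends it to \<open>T m\<close>, its \<open>p\<close>-sum dominates a positive multiple of the \<open>p\<close>-sum of \<open>T m\<close>
  (\<open>lp_bounded_linear_powr_bound\<close>), and the lower frame bound of \<open>T m\<close> carries over.
\<close>

lemma norm_sum_powr_le:
  fixes f :: "'a \<Rightarrow> 'b::real_normed_vector"
  assumes "finite A" and "0 \<le> p"
  shows "norm (\<Sum>k\<in>A. f k) powr p \<le> real (card A) powr p * (\<Sum>k\<in>A. norm (f k) powr p)"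
proof (cases "A = {}")
  case False
  define b where "b = Max ((\<lambda>k. norm (f k)) ` A)"
  have "b \<in> (\<lambda>k. norm (f k)) ` A"
    unfolding b_def using assms False by (intro Max_in) auto
  then obtain j where j: "j \<in> A" "b = norm (f j)" by blast
  have "norm (f k) \<le> b" if "k \<in> A" for k
    unfolding b_def using assms that by (intro Max_ge) auto
  then have "norm (\<Sum>k\<in>A. f k) \<le> real (card A) * b"
    by (rule sum_norm_bound)
  then have "norm (\<Sum>k\<in>A. f k) powr p \<le> (real (card A) * b) powr p"
    using assms by (intro powr_mono2) auto
  also have "\<dots> = real (card A) powr p * norm (f j) powr p"
    using j by (simp add: powr_mult)
  also have "\<dots> \<le> real (card A) powr p * (\<Sum>k\<in>A. norm (f k) powr p)"
    using assms j by (intro mult_left_mono member_le_sum) auto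
  finally show ?thesis .
qed simp

lemma norm_diff_powr_le:
  fixes x y :: "'b::real_normed_vector"
  assumes "0 \<le> p"
  shows "norm (x - y) powr p \<le> 2 powr p * (norm x powr p + norm y powr p)"
  \<comment> \<open>a sum of two terms, indexed by the Booleans\<close>
  using norm_sum_powr_le[of "UNIV :: bool set" p "\<lambda>b. if b then x else - y"] assms
  by (simp add: UNIV_bool add.commute)

text \<open>
  No non-negativity of \<open>N\<close> is assumed, so the empty sum is excluded: the zero functional satisfies
  the bound only if \<open>N (x # a)\<close> is never negative.
\<close>

lemma b_dual_sum:
  fixes R :: "'j \<Rightarrow> 'x::ab_group_add list \<Rightarrow> 'k::real_normed_field"
  assumes "finite K" and "K \<noteq> {}" and R: "\<And>k. k \<in> K \<Longrightarrow> R k \<in> b_dual scl N a"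
  shows "(\<lambda>v. \<Sum>k\<in>K. R k v) \<in> b_dual scl N a"
proof -
  have "\<forall>k\<in>K. \<exists>M>0. \<forall>x. norm (R k (x # a)) \<le> M * N (x # a)"
    using R by (auto simp: b_dual_def)
  then obtain M where M: "\<And>k. k \<in> K \<Longrightarrow> M k > 0"
      "\<And>k x. k \<in> K \<Longrightarrow> norm (R k (x # a)) \<le> M k * N (x # a)"
    by metis
  have "norm (\<Sum>k\<in>K. R k (x # a)) \<le> (\<Sum>k\<in>K. M k) * N (x # a)" for x
    unfolding sum_distrib_right by (rule sum_norm_le) (rule M)
  moreover have "(\<Sum>k\<in>K. M k) > 0"
    using assms M by (intro sum_pos) auto
  ultimately show ?thesis
    using R unfolding b_dual_def
    by (auto simp: sum.distrib sum_distrib_left intro!: sum.neutral exI[of _ "\<Sum>k\<in>K. M k"])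
qed

text \<open>
  Passing from \<open>p\<close>-sums to norms and back gives the constant \<open>C\<close> to the \<open>p\<close>; enlarging \<open>C\<close> to at
  least \<open>1\<close> makes it invertible.
\<close>

lemma lp_bounded_linear_powr_bound:
  fixes Q :: "('i \<Rightarrow> 'k::real_normed_field) \<Rightarrow> ('i \<Rightarrow> 'k)"
  assumes "lp_bounded_linear p I Q" and "0 < p"
  obtains D where "D > 0"
    and "\<And>f. f \<in> lp_space p I \<Longrightarrow>
      (\<Sum>\<^sub>\<infinity>i\<in>I. norm (Q f i) powr p) \<le> D * (\<Sum>\<^sub>\<infinity>i\<in>I. norm (f i) powr p)"
proof -
  obtain C where C: "\<And>f. f \<in> lp_space p I \<Longrightarrow> lp_norm p I (Q f) \<le> C * lp_norm p I f"
    using assms(1) unfolding lp_bounded_linear_def by blast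
  have nonneg: "0 \<le> (\<Sum>\<^sub>\<infinity>i\<in>I. norm (f i) powr p)" for f :: "'i \<Rightarrow> 'k"
    by (rule infsum_nonneg) simp
  have pow: "lp_norm p I f powr p = (\<Sum>\<^sub>\<infinity>i\<in>I. norm (f i) powr p)" for f :: "'i \<Rightarrow> 'k"
    using assms(2) nonneg[of f] by (simp add: lp_norm_def powr_powr)
  show thesis
  proof (rule that[of "max C 1 powr p"])
    show "max C 1 powr p > 0" by simp
  next
    fix f :: "'i \<Rightarrow> 'k"
    assume f: "f \<in> lp_space p I"
    have "lp_norm p I (Q f) \<le> max C 1 * lp_norm p I f"
      by (rule order_trans[OF C[OF f]]) (auto intro: mult_right_mono simp: lp_norm_def)
    then have "lp_norm p I (Q f) powr p \<le> (max C 1 * lp_norm p I f) powr p"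
      using assms(2) by (intro powr_mono2) (auto simp: lp_norm_def)
    then show "(\<Sum>\<^sub>\<infinity>i\<in>I. norm (Q f i) powr p)
        \<le> max C 1 powr p * (\<Sum>\<^sub>\<infinity>i\<in>I. norm (f i) powr p)"
      by (simp add: powr_mult pow)
  qed
qed

lemma perturbed_powr_infsum_le:
  fixes t r :: "'i \<Rightarrow> 'b::real_normed_vector"
  assumes "0 \<le> p"
    and t: "(\<lambda>i. norm (t i) powr p) summable_on I"
    and d: "(\<lambda>i. norm (t i - r i) powr p) summable_on I"
    and le: "(\<Sum>\<^sub>\<infinity>i\<in>I. norm (t i - r i) powr p) \<le> lam * (\<Sum>\<^sub>\<infinity>i\<in>I. norm (t i) powr p)"
  shows "(\<lambda>i. norm (r i) powr p) summable_on I"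
    and "(\<Sum>\<^sub>\<infinity>i\<in>I. norm (r i) powr p)
      \<le> 2 powr p * (1 + lam) * (\<Sum>\<^sub>\<infinity>i\<in>I. norm (t i) powr p)"
proof -
  let ?h = "\<lambda>i. 2 powr p * (norm (t i) powr p + norm (t i - r i) powr p)"
  have ptw: "norm (r i) powr p \<le> ?h i" for i
    using norm_diff_powr_le[OF assms(1), of "t i" "t i - r i"] by simp
  have h: "?h summable_on I"
    by (intro summable_on_cmult_right summable_on_add t d)
  show r: "(\<lambda>i. norm (r i) powr p) summable_on I"
    by (rule summable_on_comparison_test[OF h ptw]) simp
  have "(\<Sum>\<^sub>\<infinity>i\<in>I. norm (r i) powr p) \<le> infsum ?h I"
    by (rule infsum_mono[OF r h ptw])
  also have "\<dots> = 2 powr p *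
      ((\<Sum>\<^sub>\<infinity>i\<in>I. norm (t i) powr p) + (\<Sum>\<^sub>\<infinity>i\<in>I. norm (t i - r i) powr p))"
    by (simp add: infsum_cmult_right' infsum_add[OF t d])
  also have "\<dots> \<le> 2 powr p *
      ((\<Sum>\<^sub>\<infinity>i\<in>I. norm (t i) powr p) + lam * (\<Sum>\<^sub>\<infinity>i\<in>I. norm (t i) powr p))"
    using le by (intro mult_left_mono add_left_mono) auto
  finally show "(\<Sum>\<^sub>\<infinity>i\<in>I. norm (r i) powr p)
      \<le> 2 powr p * (1 + lam) * (\<Sum>\<^sub>\<infinity>i\<in>I. norm (t i) powr p)"
    by (simp add: algebra_simps)
qed

lemma sum_powr_infsum_le:
  fixes r :: "'j \<Rightarrow> 'i \<Rightarrow> 'b::real_normed_vector"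
  assumes "finite K" and "0 \<le> p"
    and r: "\<And>k. k \<in> K \<Longrightarrow> (\<lambda>i. norm (r k i) powr p) summable_on I"
  shows "(\<lambda>i. norm (\<Sum>k\<in>K. r k i) powr p) summable_on I"
    and "(\<Sum>\<^sub>\<infinity>i\<in>I. norm (\<Sum>k\<in>K. r k i) powr p)
      \<le> real (card K) powr p * (\<Sum>k\<in>K. \<Sum>\<^sub>\<infinity>i\<in>I. norm (r k i) powr p)"
proof -
  let ?h = "\<lambda>i. real (card K) powr p * (\<Sum>k\<in>K. norm (r k i) powr p)"
  have "((\<lambda>i. \<Sum>k\<in>K. norm (r k i) powr p) has_sum
      (\<Sum>k\<in>K. \<Sum>\<^sub>\<infinity>i\<in>I. norm (r k i) powr p)) I"
    using assms(1) r by (induction K) (auto intro!: has_sum_add has_sum_infsum)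
  then have hs: "(?h has_sum real (card K) powr p * (\<Sum>k\<in>K. \<Sum>\<^sub>\<infinity>i\<in>I. norm (r k i) powr p)) I"
    by (rule has_sum_cmult_right)
  then have h: "?h summable_on I"
    by (rule has_sum_imp_summable)
  have ptw: "norm (\<Sum>k\<in>K. r k i) powr p \<le> ?h i" for i
    by (rule norm_sum_powr_le[OF assms(1,2)])
  show s: "(\<lambda>i. norm (\<Sum>k\<in>K. r k i) powr p) summable_on I"
    by (rule summable_on_comparison_test[OF h ptw]) simp
  show "(\<Sum>\<^sub>\<infinity>i\<in>I. norm (\<Sum>k\<in>K. r k i) powr p)
      \<le> real (card K) powr p * (\<Sum>k\<in>K. \<Sum>\<^sub>\<infinity>i\<in>I. norm (r k i) powr p)"
    using infsum_mono[OF s h ptw] infsumI[OF hs] by simp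
qed

theorem theorem5p5:
  fixes scl :: "'k::real_normed_field \<Rightarrow> 'x::ab_group_add \<Rightarrow> 'x"
    and n l m :: nat and N :: "'x list \<Rightarrow> real" and a :: "'x list"
    and p lam :: real and I :: "'i set"
    and T R :: "nat \<Rightarrow> 'i \<Rightarrow> 'x list \<Rightarrow> 'k"
    and Q :: "('i \<Rightarrow> 'k) \<Rightarrow> ('i \<Rightarrow> 'k)"
  assumes "n_Banach_space scl n N"
    and "length a = n - 1"
    and "1 < p"
    and "countable I"
    and "\<And>k. k \<in> {1..l} \<Longrightarrow> p_frame scl N a p I (T k)"
    and "\<And>k i. k \<in> {1..l} \<Longrightarrow> i \<in> I \<Longrightarrow> R k i \<in> b_dual scl N a"
    and "lp_bounded_linear p I Q"
    and "m \<in> {1..l}"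
    and "\<And>x. Q (seq_on I (\<lambda>i. \<Sum>k=1..l. R k i (x # a))) = seq_on I (\<lambda>i. T m i (x # a))"
    and "0 \<le> lam"
    and "\<And>k x. k \<in> {1..l} \<Longrightarrow>
           (\<lambda>i. norm (T k i (x # a) - R k i (x # a)) powr p) summable_on I \<and>
           (\<Sum>\<^sub>\<infinity>i\<in>I. norm (T k i (x # a) - R k i (x # a)) powr p)
             \<le> lam * (\<Sum>\<^sub>\<infinity>i\<in>I. norm (T k i (x # a)) powr p)"
  shows "p_frame scl N a p I (\<lambda>i v. \<Sum>k=1..l. R k i v)"
proof -
  have l: "l \<ge> 1" and p: "0 \<le> p" "0 < p"
    using assms(3,8) by auto
  let ?S = "\<lambda>x i. \<Sum>k=1..l. R k i (x # a)"
  have "\<forall>k\<in>{1..l}. \<exists>B>0. \<forall>x. (\<lambda>i. norm (T k i (x # a)) powr p) summable_on I \<and>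
      (\<Sum>\<^sub>\<infinity>i\<in>I. norm (T k i (x # a)) powr p) \<le> B * N (x # a) powr p"
    using assms(5) unfolding p_frame_def by blast
  then obtain B where B: "\<And>k. k \<in> {1..l} \<Longrightarrow> B k > 0"
    and T: "\<And>k x. k \<in> {1..l} \<Longrightarrow> (\<lambda>i. norm (T k i (x # a)) powr p) summable_on I"
    and TB: "\<And>k x. k \<in> {1..l} \<Longrightarrow>
      (\<Sum>\<^sub>\<infinity>i\<in>I. norm (T k i (x # a)) powr p) \<le> B k * N (x # a) powr p"
    by metis
  obtain A where A: "A > 0"
    "\<And>x. A * N (x # a) powr p \<le> (\<Sum>\<^sub>\<infinity>i\<in>I. norm (T m i (x # a)) powr p)"
    using assms(5)[OF assms(8)] unfolding p_frame_def by blast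
  obtain D where D: "D > 0" "\<And>f. f \<in> lp_space p I \<Longrightarrow>
      (\<Sum>\<^sub>\<infinity>i\<in>I. norm (Q f i) powr p) \<le> D * (\<Sum>\<^sub>\<infinity>i\<in>I. norm (f i) powr p)"
    using lp_bounded_linear_powr_bound[OF assms(7) p(2)] by blast

  have Rs: "(\<lambda>i. norm (R k i (x # a)) powr p) summable_on I"
    and RB: "(\<Sum>\<^sub>\<infinity>i\<in>I. norm (R k i (x # a)) powr p)
      \<le> 2 powr p * (1 + lam) * B k * N (x # a) powr p" if k: "k \<in> {1..l}" for k x
  proof -
    note d = assms(11)[OF k, of x]
    note pert = perturbed_powr_infsum_le[OF p(1) T[OF k] conjunct1[OF d] conjunct2[OF d]]
    show "(\<lambda>i. norm (R k i (x # a)) powr p) summable_on I"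
      by (rule pert(1))
    have "2 powr p * (1 + lam) * (\<Sum>\<^sub>\<infinity>i\<in>I. norm (T k i (x # a)) powr p)
        \<le> 2 powr p * (1 + lam) * (B k * N (x # a) powr p)"
      using TB[OF k] assms(10) by (intro mult_left_mono) auto
    from order_trans[OF pert(2) this] show "(\<Sum>\<^sub>\<infinity>i\<in>I. norm (R k i (x # a)) powr p)
        \<le> 2 powr p * (1 + lam) * B k * N (x # a) powr p"
      by (simp only: mult.assoc)
  qed
  have S: "(\<lambda>i. norm (?S x i) powr p) summable_on I" for x
    by (rule sum_powr_infsum_le(1)) (use p Rs in auto)

  define U where "U = real l powr p * (\<Sum>k=1..l. 2 powr p * (1 + lam) * B k)"
  have "U > 0"
    unfolding U_def using l assms(10) B
    by (intro mult_pos_pos sum_pos) auto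
  moreover have "(\<Sum>\<^sub>\<infinity>i\<in>I. norm (?S x i) powr p) \<le> U * N (x # a) powr p" for x
  proof -
    have "(\<Sum>\<^sub>\<infinity>i\<in>I. norm (?S x i) powr p)
        \<le> real (card {1..l}) powr p * (\<Sum>k=1..l. \<Sum>\<^sub>\<infinity>i\<in>I. norm (R k i (x # a)) powr p)"
      by (rule sum_powr_infsum_le(2)) (use p Rs in auto)
    also have "\<dots> \<le> real (card {1..l}) powr p *
        (\<Sum>k=1..l. 2 powr p * (1 + lam) * B k * N (x # a) powr p)"
      by (intro mult_left_mono sum_mono RB) auto
    also have "\<dots> = U * N (x # a) powr p"
      by (simp add: U_def sum_distrib_right mult.assoc)
    finally show ?thesis .
  qed
  moreover have "A / D > 0"
    using A(1) D(1) by simp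
  moreover have "A / D * N (x # a) powr p \<le> (\<Sum>\<^sub>\<infinity>i\<in>I. norm (?S x i) powr p)" for x
  proof -
    have on: "(\<Sum>\<^sub>\<infinity>i\<in>I. norm (seq_on I f i) powr p) = (\<Sum>\<^sub>\<infinity>i\<in>I. norm (f i) powr p)"
      for f :: "'i \<Rightarrow> 'k"
      by (rule infsum_cong) (simp add: seq_on_def)
    have "(\<lambda>i. norm (seq_on I (?S x) i) powr p) summable_on I"
      using S[of x] by (rule summable_on_cong[THEN iffD1, rotated]) (simp add: seq_on_def)
    then have "seq_on I (?S x) \<in> lp_space p I"
      by (simp add: lp_space_def seq_on_def)
    from D(2)[OF this] have "(\<Sum>\<^sub>\<infinity>i\<in>I. norm (T m i (x # a)) powr p)
        \<le> D * (\<Sum>\<^sub>\<infinity>i\<in>I. norm (?S x i) powr p)"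
      by (simp only: assms(9) on)
    with A(2)[of x] have "A * N (x # a) powr p \<le> D * (\<Sum>\<^sub>\<infinity>i\<in>I. norm (?S x i) powr p)"
      by linarith
    then show ?thesis
      using D(1) by (simp add: field_simps)
  qed
  moreover have "(\<lambda>v. \<Sum>k=1..l. R k i v) \<in> b_dual scl N a" if "i \<in> I" for i
    using l assms(6) that by (intro b_dual_sum) auto
  ultimately show ?thesis
    unfolding p_frame_def using S by blast
qed

end
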